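(* Let $G=(V,E)$ be an infinite, connected, locally finite graph with vertex weight $\omega:V\to\mathbb{R}_+^\star$ and edge conductance $c:E\to\mathbb{R}_+^\star$, and let $U_\omega:l^2_\omega(V)\to l^2(V)$, $U_\omega(f)=\omega f$. If $$\widehat{\Delta}=U_\omega\,\Delta_{\omega,c}\,U_\omega^{-1},$$ then $\widehat{\Delta}$ is a Schrödinger operator of $G$, and $$\widehat{\Delta}=\Delta_{1,a}+W,$$ where $a$ is the strictly positive function on $E$ given by $a_{x,y}=\dfrac{c_{x,y}}{\omega_x\omega_y}$ and the potential $W:V\to\mathbb{R}$ is given by $W=-\dfrac{1}{\omega}\,\Delta_{1,a}\omega$.
   Context: $G=(V,E)$ is a graph with vertex set $V$ and edge set $E$, whose edges are unordered pairs $\{x,y\}$ of distinct vertices; $x\sim y$ means $\{x,y\}\in E$. $\mathbb{R}_+^\star=(0,\infty)$. A function $c$ on $E$ is written $c_{x,y}=c_{y,x}$ for $\{x,y\}\in E$. $C_0(V)$ is the space of finitely supported functions $V\to\mathbb{R}$. $l^2_\omega(V)=\{f:V\to\mathbb{R}:\sum_{x\in V}\omega_x^2|f(x)|^2<\infty\}$ with scalar product $\langle f,g\rangle_{l^2_\omega}=\sum_{x\in V}\omega_x^2f(x)g(x)$; $l^2(V)$ is the case $\omega\equiv1$. The map $U_\omega$ is unitary and preserves $C_0(V)$. The weighted graph Laplacian is $(\Delta_{\omega,c}f)(x)=\frac{1}{\omega_x^2}\sum_{y\sim x}c_{x,y}(f(x)-f(y))$; thus $(\Delta_{1,a}f)(x)=\sum_{y\sim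 x}a_{x,y}(f(x)-f(y))$, which is defined for every function $f:V\to\mathbb{R}$. A Schrödinger operator of $G$ is an operator of the form $\Delta_{1,a}+W$ acting on functions of $l^2(V)$, where $W:V\to\mathbb{R}$ (acting by multiplication) and $a:E\to\mathbb{R}_+^\star$. All operators are taken with domain $C_0(V)$. *)

theory Defs
  imports "HOL-Analysis.Analysis"
begin

definition graph :: "'v set \<Rightarrow> 'v set set \<Rightarrow> bool" where
  "graph V E \<longleftrightarrow> (\<forall>e\<in>E. \<exists>x\<in>V. \<exists>y\<in>V. x \<noteq> y \<and> e = {x, y})"

definition neighbours :: "'v set \<Rightarrow> 'v set set \<Rightarrow> 'v \<Rightarrow> 'v set" where
  "neighbours V E x = {y \<in> V. {x, y} \<in> E}"

definition connected_graph :: "'v set \<Rightarrow> 'v set set \<Rightarrow> bool" where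
  "connected_graph V E \<longleftrightarrow> (\<forall>x\<in>V. \<forall>y\<in>V. (x, y) \<in> {(u, v). {u, v} \<in> E}\<^sup>*)"

definition locally_finite_graph :: "'v set \<Rightarrow> 'v set set \<Rightarrow> bool" where
  "locally_finite_graph V E \<longleftrightarrow> (\<forall>x\<in>V. finite (neighbours V E x))"

text \<open>
  Real functions on \<open>V\<close> are the elements of \<open>extensional V\<close>, so that two functions agreeing
  on \<open>V\<close> are equal. A function on edges takes the edge \<open>{x, y}\<close> as its argument and is therefore
  automatically symmetric.
\<close>

definition C0 :: "'v set \<Rightarrow> ('v \<Rightarrow> real) set" where
  "C0 V = {f \<in> extensional V. finite {x \<in> V. f x \<noteq> 0}}"

definition l2 :: "'v set \<Rightarrow> ('v \<Rightarrow> real) \<Rightarrow> ('v \<Rightarrow> real) set" where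
  "l2 V \<omega> = {f \<in> extensional V. (\<lambda>x. (\<omega> x)\<^sup>2 * \<bar>f x\<bar>\<^sup>2) summable_on V}"

definition laplacian ::
    "'v set \<Rightarrow> 'v set set \<Rightarrow> ('v \<Rightarrow> real) \<Rightarrow> ('v set \<Rightarrow> real) \<Rightarrow> ('v \<Rightarrow> real) \<Rightarrow> ('v \<Rightarrow> real)" where
  "laplacian V E \<omega> c f =
     (\<lambda>x\<in>V. 1 / (\<omega> x)\<^sup>2 * (\<Sum>y\<in>neighbours V E x. c {x, y} * (f x - f y)))"

text \<open>
  An operator is a partial map between functions whose \<open>dom\<close> is the domain of the operator.
  Composition of operators, with its natural domain, is then \<open>\<circ>\<^sub>m\<close>, and equality of operators
  includes equality of their domains.
\<close>

type_synonym 'v operator = "('v \<Rightarrow> real) \<rightharpoonup> ('v \<Rightarrow> real)"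

text \<open>The inverse has domain \<open>ran T\<close>; it is meaningful for injective \<open>T\<close> only.\<close>

definition inverse_op :: "'v operator \<Rightarrow> 'v operator" where
  "inverse_op T = (\<lambda>g. if g \<in> ran T then Some (THE f. T f = Some g) else None)"

definition U_op :: "'v set \<Rightarrow> ('v \<Rightarrow> real) \<Rightarrow> 'v operator" where
  "U_op V \<omega> = (\<lambda>f. Some (\<lambda>x\<in>V. \<omega> x * f x)) |` l2 V \<omega>"

definition laplacian_op ::
    "'v set \<Rightarrow> 'v set set \<Rightarrow> ('v \<Rightarrow> real) \<Rightarrow> ('v set \<Rightarrow> real) \<Rightarrow> 'v operator" where
  "laplacian_op V E \<omega> c = (\<lambda>f. Some (laplacian V E \<omega> c f)) |` C0 V"

text \<open>The operator \<open>\<Delta>\<^bsub>1,a\<^esub> + W\<close> with domain \<open>C0 V\<close>.\<close>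

definition schroedinger_op ::
    "'v set \<Rightarrow> 'v set set \<Rightarrow> ('v set \<Rightarrow> real) \<Rightarrow> ('v \<Rightarrow> real) \<Rightarrow> 'v operator" where
  "schroedinger_op V E a W =
     (\<lambda>f. Some (\<lambda>x\<in>V. laplacian V E (\<lambda>_. 1) a f x + W x * f x)) |` C0 V"

definition is_schroedinger_op :: "'v set \<Rightarrow> 'v set set \<Rightarrow> 'v operator \<Rightarrow> bool" where
  "is_schroedinger_op V E T \<longleftrightarrow>
     (\<exists>a W. (\<forall>e\<in>E. 0 < a e) \<and> T = schroedinger_op V E a W)"

end

theory Submission
  imports Defs
begin

text \<open>Put \<open>f\<close> = \<open>g / \<omega>\<close>. At \<open>x\<close>, the conjugated
  operator gives the sum over neighbours \<open>y\<close> of (c / \<omega> x) * (g x / \<omega> x -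
  g y / \<omega> y). With a = c / (\<omega> x * \<omega> y), each term equals a * (g x - g y) minus
  a * (\<omega> x - \<omega> y) * (g x / \<omega> x). Summing the first parts gives the Laplacian of
  \<open>g\<close> with weight 1. In the second parts the factor g x / \<omega> x does not depend on
  \<open>y\<close>, so they sum to a multiplication operator, the potential. This is
  \<open>laplacian_conjugate\<close>.

  Since operators here are partial maps, their domains must also agree. Division by the positive
  weight preserves and reflects finite support (\<open>restrict_divide_C0_iff\<close>), and by local
  finiteness the Laplacian stays in \<open>C0 V\<close> (\<open>laplacian_C0\<close>), which lies in
  the domain of \<open>U_op\<close> (\<open>C0_subset_l2\<close>). Hence the composition is defined
  exactly on \<open>C0 V\<close>.\<close>

lemma neighbours_sym: "y \<in> neighbours V E x \<Longrightarrow> x \<in> V \<Longrightarrow> x \<in> neighbours V E y"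
  by (simp add: neighbours_def insert_commute)

lemma C0_subset_l2: "C0 V \<subseteq> l2 V \<omega>"
proof
  fix f assume f: "f \<in> C0 V"
  let ?S = "{x \<in> V. f x \<noteq> 0}"
  have "(\<lambda>x. (\<omega> x)\<^sup>2 * \<bar>f x\<bar>\<^sup>2) summable_on V
      \<longleftrightarrow> (\<lambda>x. (\<omega> x)\<^sup>2 * \<bar>f x\<bar>\<^sup>2) summable_on ?S"
    \<comment> \<open>The terms vanish off the support, so only a finite sum remains.\<close>
    by (rule summable_on_cong_neutral) auto
  then show "f \<in> l2 V \<omega>"
    using f by (simp add: C0_def l2_def)
qed

text \<open>The Laplacian enlarges the support by at most the neighbours of its points, and local
  finiteness makes that enlargement finite.\<close>

lemma laplacian_C0:
  assumes "locally_finite_graph V E" and f: "f \<in> C0 V"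
  shows "laplacian V E \<omega> c f \<in> C0 V"
proof -
  let ?S = "{x \<in> V. f x \<noteq> 0}"
  have "x \<in> ?S \<union> (\<Union>y\<in>?S. neighbours V E y)"
    if x: "x \<in> V" "laplacian V E \<omega> c f x \<noteq> 0" for x
  proof (rule ccontr)
    assume contra: "x \<notin> ?S \<union> (\<Union>y\<in>?S. neighbours V E y)"
    have "f y = 0" if "y \<in> neighbours V E x" for y
      using contra x(1) that neighbours_sym[OF that x(1)] by (auto simp: neighbours_def)
    with contra x show False
      by (simp add: laplacian_def)
  qed
  then have "{x \<in> V. laplacian V E \<omega> c f x \<noteq> 0} \<subseteq> ?S \<union> (\<Union>y\<in>?S. neighbours V E y)"
    by blast
  moreover have "finite (?S \<union> (\<Union>y\<in>?S. neighbours V E y))"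
    using assms by (auto simp: C0_def locally_finite_graph_def)
  ultimately have "finite {x \<in> V. laplacian V E \<omega> c f x \<noteq> 0}"
    by (rule finite_subset)
  then show ?thesis
    by (simp add: C0_def laplacian_def)
qed

lemma restrict_divide_C0_iff:
  assumes "\<forall>x\<in>V. 0 < \<omega> x" and "g \<in> extensional V"
  shows "(\<lambda>x\<in>V. g x / \<omega> x) \<in> C0 V \<longleftrightarrow> g \<in> C0 V"
proof -
  have "{x \<in> V. (\<lambda>x\<in>V. g x / \<omega> x) x \<noteq> 0} = {x \<in> V. g x \<noteq> 0}"
    using assms(1) by auto
  then show ?thesis
    unfolding C0_def mem_Collect_eq using assms(2) by (simp only: restrict_extensional)
qed

text \<open>Solving the defining equation for the preimage yields both the injectivity of
  \<open>U_op\<close> and its range; \<open>inverse_U_op\<close> reads the inverse off from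
  this.\<close>

lemma U_op_eq_Some_iff:
  assumes "\<forall>x\<in>V. 0 < \<omega> x"
  shows "U_op V \<omega> f = Some g \<longleftrightarrow>
    f \<in> l2 V \<omega> \<and> g \<in> extensional V \<and> f = (\<lambda>x\<in>V. g x / \<omega> x)"
proof -
  have "(\<lambda>x\<in>V. \<omega> x * f x) = g \<longleftrightarrow> g \<in> extensional V \<and> f = (\<lambda>x\<in>V. g x / \<omega> x)"
    if "f \<in> extensional V"
  proof
    assume "(\<lambda>x\<in>V. \<omega> x * f x) = g"
    then show "g \<in> extensional V \<and> f = (\<lambda>x\<in>V. g x / \<omega> x)"
      using assms that by (force simp: fun_eq_iff extensional_def)
  next
    assume "g \<in> extensional V \<and> f = (\<lambda>x\<in>V. g x / \<omega> x)"
    then show "(\<lambda>x\<in>V. \<omega> x * f x) = g"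
      using assms by (force simp: fun_eq_iff extensional_def)
  qed
  moreover have "U_op V \<omega> f = Some g \<longleftrightarrow> f \<in> l2 V \<omega> \<and> (\<lambda>x\<in>V. \<omega> x * f x) = g"
    by (simp add: U_op_def restrict_map_def)
  moreover have "f \<in> extensional V" if "f \<in> l2 V \<omega>"
    using that by (simp add: l2_def)
  ultimately show ?thesis
    by blast
qed

lemma inverse_U_op:
  assumes "\<forall>x\<in>V. 0 < \<omega> x"
  shows "inverse_op (U_op V \<omega>) g =
    (if g \<in> extensional V \<and> (\<lambda>x\<in>V. g x / \<omega> x) \<in> l2 V \<omega>
     then Some (\<lambda>x\<in>V. g x / \<omega> x) else None)"
proof -
  have "g \<in> ran (U_op V \<omega>) \<longleftrightarrow>
      g \<in> extensional V \<and> (\<lambda>x\<in>V. g x / \<omega> x) \<in> l2 V \<omega>"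
    unfolding ran_def U_op_eq_Some_iff[OF assms] by blast
  moreover have "(THE f. U_op V \<omega> f = Some g) = (\<lambda>x\<in>V. g x / \<omega> x)"
    if "g \<in> extensional V" "(\<lambda>x\<in>V. g x / \<omega> x) \<in> l2 V \<omega>"
    unfolding U_op_eq_Some_iff[OF assms] by (rule the_equality) (use that in blast)+
  ultimately show ?thesis
    unfolding inverse_op_def by simp
qed

lemma laplacian_conjugate:
  assumes pos: "\<forall>x\<in>V. 0 < \<omega> x"
    and x: "x \<in> V"
    and a: "\<And>y. y \<in> neighbours V E x \<Longrightarrow> a {x, y} = c {x, y} / (\<omega> x * \<omega> y)"
  shows "\<omega> x * laplacian V E \<omega> c (\<lambda>x\<in>V. g x / \<omega> x) x =
    laplacian V E (\<lambda>_. 1) a g x - (1 / \<omega> x) * laplacian V E (\<lambda>_. 1) a \<omega> x * g x"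
proof -
  let ?N = "neighbours V E x"
  have "\<omega> x * laplacian V E \<omega> c (\<lambda>x\<in>V. g x / \<omega> x) x
      = (\<Sum>y\<in>?N. c {x, y} / \<omega> x * (g x / \<omega> x - g y / \<omega> y))"
  proof -
    have "\<omega> x \<noteq> 0"
      using x pos by force
    then show ?thesis
      using x by (auto simp: laplacian_def neighbours_def sum_distrib_left power2_eq_square
          intro!: sum.cong)
  qed
  \<comment> \<open>Adding and subtracting a * g x turns the weighted difference into a plain
    difference plus a multiple of g x; the multiple is written through \<omega> x - \<omega> y so
    that it sums to the Laplacian of \<omega>.\<close>
  also have "\<dots> = (\<Sum>y\<in>?N. a {x, y} * (g x - g y) - a {x, y} * (\<omega> x - \<omega> y) * (g x / \<omega> x))"
  proof (rule sum.cong[OF refl])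
    fix y assume y: "y \<in> ?N"
    then have "0 < \<omega> x" "0 < \<omega> y"
      using x pos by (auto simp: neighbours_def)
    then show "c {x, y} / \<omega> x * (g x / \<omega> x - g y / \<omega> y)
        = a {x, y} * (g x - g y) - a {x, y} * (\<omega> x - \<omega> y) * (g x / \<omega> x)"
      by (simp add: a[OF y] field_simps)
  qed
  also have "\<dots> = laplacian V E (\<lambda>_. 1) a g x - (1 / \<omega> x) * laplacian V E (\<lambda>_. 1) a \<omega> x * g x"
    using x by (simp add: laplacian_def sum_subtractf sum_distrib_right sum_divide_distrib)
  finally show ?thesis .
qed

theorem proposition2p1:
  fixes V :: "'v set" and E :: "'v set set"
    and \<omega> :: "'v \<Rightarrow> real" and c :: "'v set \<Rightarrow> real"
    and a :: "'v set \<Rightarrow> real" and W :: "'v \<Rightarrow> real" and \<Delta>hat :: "'v operator"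
  assumes "graph V E" and "infinite V" and "connected_graph V E" and "locally_finite_graph V E"
    and "\<forall>x\<in>V. 0 < \<omega> x" and "\<forall>e\<in>E. 0 < c e"
    and \<Delta>hat: "\<Delta>hat = U_op V \<omega> \<circ>\<^sub>m (laplacian_op V E \<omega> c \<circ>\<^sub>m inverse_op (U_op V \<omega>))"
    and a: "a = (\<lambda>e. c e / (\<Prod>x\<in>e. \<omega> x))"
    and W: "W = (\<lambda>x. - (1 / \<omega> x) * laplacian V E (\<lambda>_. 1) a \<omega> x)"
  shows "is_schroedinger_op V E \<Delta>hat
    \<and> (\<forall>e\<in>E. 0 < a e)
    \<and> (\<forall>x y. {x, y} \<in> E \<longrightarrow> a {x, y} = c {x, y} / (\<omega> x * \<omega> y))
    \<and> \<Delta>hat = schroedinger_op V E a W"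
proof -
  note pos = assms(5)
  have edge: "x \<in> V \<and> y \<in> V \<and> x \<noteq> y" if e: "{x, y} \<in> E" for x y
  proof -
    obtain u v where "u \<in> V" "v \<in> V" "u \<noteq> v" "{x, y} = {u, v}"
      using bspec[OF assms(1)[unfolded graph_def] e] by blast
    then show ?thesis
      by (auto simp: doubleton_eq_iff)
  qed
  have a_pos: "\<forall>e\<in>E. 0 < a e"
  proof
    fix e assume e: "e \<in> E"
    then have "e \<subseteq> V"
      using assms(1) unfolding graph_def by fastforce
    then have "0 < (\<Prod>x\<in>e. \<omega> x)"
      using pos by (intro prod_pos) blast
    then show "0 < a e"
      using e assms(6) by (simp add: a)
  qed
  have a_edge: "a {x, y} = c {x, y} / (\<omega> x * \<omega> y)" if "{x, y} \<in> E" for x y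
    \<comment> \<open>The endpoints are distinct, so the product over the set \<open>{x, y}\<close>
      has exactly two factors.\<close>
    using edge[OF that] by (simp add: a)
  have "\<Delta>hat g = schroedinger_op V E a W g" for g
  proof (cases "g \<in> C0 V")
    case True
    let ?f = "\<lambda>x\<in>V. g x / \<omega> x"
    have g: "g \<in> extensional V"
      using True by (simp add: C0_def)
    have f: "?f \<in> C0 V"
      using True restrict_divide_C0_iff[OF pos g] by simp
    \<comment> \<open>The outer \<open>U_op\<close> is defined only on
      \<open>l2 V \<omega>\<close>.\<close>
    have Lf: "laplacian V E \<omega> c ?f \<in> l2 V \<omega>"
      using laplacian_C0[OF assms(4) f] C0_subset_l2 by blast
    have "\<Delta>hat g = Some (\<lambda>x\<in>V. \<omega> x * laplacian V E \<omega> c ?f x)"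
      using f g Lf subsetD[OF C0_subset_l2 f]
      unfolding \<Delta>hat map_comp_def inverse_U_op[OF pos]
      by (simp add: laplacian_op_def U_op_def)
    also have "(\<lambda>x\<in>V. \<omega> x * laplacian V E \<omega> c ?f x)
        = (\<lambda>x\<in>V. laplacian V E (\<lambda>_. 1) a g x + W x * g x)"
    proof (rule restrict_ext)
      fix x assume x: "x \<in> V"
      show "\<omega> x * laplacian V E \<omega> c ?f x = laplacian V E (\<lambda>_. 1) a g x + W x * g x"
        by (subst laplacian_conjugate[OF pos x, where a = a])
          (auto simp: W a_edge neighbours_def)
    qed
    finally show ?thesis
      using True by (simp only: schroedinger_op_def restrict_in)
  next
    case False
    \<comment> \<open>Both sides are \<open>None\<close>: either \<open>g\<close> is outside the
      domain of the inverse, or \<open>g / \<omega>\<close> has infinite support and is outside that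
      of the Laplacian.\<close>
    then show ?thesis
      using restrict_divide_C0_iff[OF pos, of g]
      by (auto simp: \<Delta>hat inverse_U_op[OF pos] map_comp_def laplacian_op_def
          schroedinger_op_def restrict_map_def)
  qed
  then have "\<Delta>hat = schroedinger_op V E a W"
    by blast
  then show ?thesis
    using a_pos a_edge unfolding is_schroedinger_op_def by blast
qed

end
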